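(* For every real $0<\epsilon<1/4$ and every positive integer $M$ there exists $\delta_0=\delta_0(\epsilon,M)>0$ such that the following holds for all $0<\delta<\delta_0$. Let $\tau$ be a positive integer and $\Gamma$ a $D$-regular graph on $[n]$. If at least $\epsilon n$ vertices $v$ of $\Gamma$ satisfy $\|Q^{\tau}_v-U\|<\delta$, then at least $\left(1-(\delta/\epsilon)^{1/4^M}\right)n$ vertices $v$ of $\Gamma$ satisfy $\|Q^{(M+1)\tau}_v-U\|<2e^{-\epsilon M/2}+6\delta$.
   Context: All graphs are finite simple graphs; $D\ge 1$. For a $D$-regular graph $\Gamma$ on $[n]$, the random walk moves at each step to a uniformly random neighbor of the current vertex, independently of the history; $Q^t_v$ denotes the distribution of the position after $t$ steps of the walk started at $v$. $U$ is the uniform distribution on $[n]$, and $\|P_1-P_2\|=\max_{A\subseteq[n]}|P_1(A)-P_2(A)|=\frac12\sum_j|P_1(j)-P_2(j)|$ is the total variation distance. *)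

theory Defs
  imports "HOL-Probability.Probability" "Graph_Theory.Pair_Digraph"
begin

text \<open>
  Finite simple graphs are the library's \<^const>\<open>pair_graph\<close>s: finite, symmetric, loop-free
  digraphs whose arcs are pairs of vertices. An undirected edge between two vertices is the
  pair of its two opposite arcs, so the degree of a vertex is its number of neighbours.
\<close>

definition neighbours :: "'a pair_pre_digraph \<Rightarrow> 'a \<Rightarrow> 'a set" where
  "neighbours G v = {w \<in> pverts G. (v, w) \<in> parcs G}"

definition regular_graph :: "nat \<Rightarrow> 'a pair_pre_digraph \<Rightarrow> bool" where
  "regular_graph D G \<longleftrightarrow> pair_graph G \<and> (\<forall>v \<in> pverts G. card (neighbours G v) = D)"

text \<open>
  The walk is only meaningful if every vertex has a neighbour, since \<^const>\<open>pmf_of_set\<close> is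
  unspecified on the empty set.
\<close>

primrec walk_dist :: "'a pair_pre_digraph \<Rightarrow> nat \<Rightarrow> 'a \<Rightarrow> 'a pmf" where
  "walk_dist G 0 v = return_pmf v"
| "walk_dist G (Suc t) v = bind_pmf (walk_dist G t v) (\<lambda>u. pmf_of_set (neighbours G u))"

definition tv_dist :: "'a set \<Rightarrow> 'a pmf \<Rightarrow> 'a pmf \<Rightarrow> real" where
  "tv_dist V p q = Max ((\<lambda>A. \<bar>measure_pmf.prob p A - measure_pmf.prob q A\<bar>) ` Pow V)"

lemma tv_dist_half_sum:
  assumes V: "finite V" and p: "set_pmf p \<subseteq> V" and q: "set_pmf q \<subseteq> V"
  shows "tv_dist V p q = (\<Sum>j\<in>V. \<bar>pmf p j - pmf q j\<bar>) / 2"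
proof -
  define d where "d j = pmf p j - pmf q j" for j
  have dA: "measure_pmf.prob p A - measure_pmf.prob q A = sum d A" if "A \<subseteq> V" for A
    using that V by (simp add: measure_measure_pmf_finite finite_subset d_def sum_subtractf)
  have d0: "sum d V = 0"
    using p q V by (simp add: d_def sum_subtractf sum_pmf_eq_1)
  define P where "P = {j \<in> V. d j \<ge> 0}"
  have PV: "P \<subseteq> V" by (auto simp: P_def)
  have split: "sum f V = sum f P + sum f (V - P)" for f :: "'a \<Rightarrow> real"
    using V PV by (metis add.commute sum.subset_diff)
  have aP: "(\<Sum>j\<in>P. \<bar>d j\<bar>) = sum d P"
    by (rule sum.cong) (auto simp: P_def)
  have aN: "(\<Sum>j\<in>V-P. \<bar>d j\<bar>) = - sum d (V - P)"
    unfolding sum_negf[symmetric] by (rule sum.cong) (auto simp: P_def)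
  have half: "(\<Sum>j\<in>V. \<bar>d j\<bar>) / 2 = sum d P"
    using split[of d] split[of "\<lambda>j. \<bar>d j\<bar>"] aP aN d0 by simp
  have le: "\<bar>sum d A\<bar> \<le> (\<Sum>j\<in>V. \<bar>d j\<bar>) / 2" if A: "A \<subseteq> V" for A
  proof -
    have "sum d V = sum d A + sum d (V - A)"
      using V A by (metis add.commute sum.subset_diff)
    moreover have "(\<Sum>j\<in>V. \<bar>d j\<bar>) = (\<Sum>j\<in>A. \<bar>d j\<bar>) + (\<Sum>j\<in>V-A. \<bar>d j\<bar>)"
      using V A by (metis add.commute sum.subset_diff)
    moreover have "\<bar>sum d A\<bar> \<le> (\<Sum>j\<in>A. \<bar>d j\<bar>)" "\<bar>sum d (V - A)\<bar> \<le> (\<Sum>j\<in>V-A. \<bar>d j\<bar>)"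
      by (rule sum_abs)+
    ultimately show ?thesis using d0 by linarith
  qed
  have P0: "sum d P \<ge> 0" by (rule sum_nonneg) (auto simp: P_def)
  have "tv_dist V p q = (\<Sum>j\<in>V. \<bar>d j\<bar>) / 2"
    unfolding tv_dist_def
  proof (rule Max_eqI)
    show "(\<Sum>j\<in>V. \<bar>d j\<bar>) / 2 \<in> (\<lambda>A. \<bar>measure_pmf.prob p A - measure_pmf.prob q A\<bar>) ` Pow V"
      using PV P0 dA[OF PV] half by (intro image_eqI[of _ _ P]) auto
  qed (use V le dA in auto)
  then show ?thesis by (simp add: d_def)
qed

end

theory Submission
  imports Defs
begin

text \<open>
  Let \<open>S\<close> be the set of vertices from which the walk is \<open>\<delta>\<close>-mixed after \<open>\<tau>\<close> steps, and look at
  the walk at multiples of \<open>\<tau>\<close>. Once it visits \<open>S\<close>, it is \<open>\<delta>\<close>-mixed one round later and stays so,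
  since the uniform distribution is stationary. By symmetry of the transition probabilities the
  set \<open>W\<close> of vertices whose chance to be in \<open>S\<close> one round later is below half of the density of
  \<open>S\<close> has at most \<open>2\<delta>n\<close> elements. As long as the walk avoids \<open>W\<close>, it misses \<open>S\<close> in each round with
  probability at most \<open>1 - \<epsilon>/2\<close>. Averaged over the starting vertex, the expected number of visits
  to \<open>W\<close> in \<open>M\<close> rounds is at most \<open>2M\<delta>\<close>, so by Markov's inequality it is at most
  \<open>exp (-\<epsilon>M/2)\<close> for all but \<open>2M\<delta> exp (\<epsilon>M/2) n\<close> starting vertices, which is fewer than
  \<open>(\<delta>/\<epsilon>) powr (1/4^M) n\<close> when \<open>\<delta>\<close> is small.
\<close>

section \<open>Distance to uniformity in a symmetric Markov semigroup\<close>

locale symmetric_markov_semigroup =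
  fixes V :: "'a set" and Q :: "nat \<Rightarrow> 'a \<Rightarrow> 'a \<Rightarrow> real"
  assumes finite_V: "finite V" and V_nonempty: "V \<noteq> {}"
    and Q_nonneg: "0 \<le> Q t v w"
    and Q_sum: "v \<in> V \<Longrightarrow> (\<Sum>w\<in>V. Q t v w) = 1"
    and Q_sym: "v \<in> V \<Longrightarrow> w \<in> V \<Longrightarrow> Q t v w = Q t w v"
    and Q_add: "v \<in> V \<Longrightarrow> w \<in> V \<Longrightarrow> Q (s + t) v w = (\<Sum>u\<in>V. Q s v u * Q t u w)"
begin

text \<open>The total variation distance between the row of \<open>v\<close> and the uniform
  distribution, in its half-l1 form.\<close>

definition dev :: "nat \<Rightarrow> 'a \<Rightarrow> real" where
  "dev t v = (\<Sum>w\<in>V. \<bar>Q t v w - 1 / card V\<bar>) / 2"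

lemma card_V_pos: "0 < card V"
  using finite_V V_nonempty by (simp add: card_gt_0_iff)

lemma Q_sum_col: "w \<in> V \<Longrightarrow> (\<Sum>v\<in>V. Q t v w) = 1"
  using Q_sum[of w t] Q_sym[of w _ t] by simp

lemma dev_le_1:
  assumes "v \<in> V"
  shows "dev t v \<le> 1"
proof -
  have "(\<Sum>w\<in>V. \<bar>Q t v w - 1 / card V\<bar>) \<le> (\<Sum>w\<in>V. Q t v w + 1 / card V)"
    by (intro sum_mono order.trans[OF abs_triangle_ineq4]) (simp add: Q_nonneg)
  also have "\<dots> = 2"
    using assms card_V_pos by (simp add: sum.distrib Q_sum)
  finally show ?thesis by (simp add: dev_def)
qed

text \<open>Convexity of the distance: after \<open>s + t\<close> steps the distribution is the
  mixture of the rows \<open>Q t u\<close> with weights \<open>Q s v u\<close>.\<close>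

lemma dev_add_le_average:
  assumes v: "v \<in> V"
  shows "dev (s + t) v \<le> (\<Sum>u\<in>V. Q s v u * dev t u)"
proof -
  have "\<bar>Q (s + t) v w - 1 / card V\<bar> \<le> (\<Sum>u\<in>V. Q s v u * \<bar>Q t u w - 1 / card V\<bar>)"
    if w: "w \<in> V" for w
  proof -
    have "Q (s + t) v w - 1 / card V = (\<Sum>u\<in>V. Q s v u * (Q t u w - 1 / card V))"
      by (simp add: right_diff_distrib sum_subtractf Q_add v w Q_sum
          flip: sum_distrib_right sum_divide_distrib)
    also have "\<bar>\<dots>\<bar> \<le> (\<Sum>u\<in>V. \<bar>Q s v u * (Q t u w - 1 / card V)\<bar>)"
      by (rule sum_abs)
    finally show ?thesis
      by (simp add: abs_mult Q_nonneg)
  qed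
  then have "(\<Sum>w\<in>V. \<bar>Q (s + t) v w - 1 / card V\<bar>)
      \<le> (\<Sum>w\<in>V. \<Sum>u\<in>V. Q s v u * \<bar>Q t u w - 1 / card V\<bar>)"
    by (rule sum_mono)
  also have "\<dots> = (\<Sum>u\<in>V. Q s v u * (\<Sum>w\<in>V. \<bar>Q t u w - 1 / card V\<bar>))"
    by (subst sum.swap) (simp add: sum_distrib_left)
  finally show ?thesis
    by (simp add: dev_def flip: sum_divide_distrib)
qed

text \<open>Column sums 1 make the uniform distribution stationary, so the deviation itself is
  pushed forward by \<open>Q t\<close>; row sums 1 then keep its l1 norm from growing.\<close>

lemma dev_add_le:
  assumes v: "v \<in> V"
  shows "dev (s + t) v \<le> dev s v"
proof -
  have "\<bar>Q (s + t) v w - 1 / card V\<bar> \<le> (\<Sum>u\<in>V. \<bar>Q s v u - 1 / card V\<bar> * Q t u w)"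
    if w: "w \<in> V" for w
  proof -
    have "Q (s + t) v w - 1 / card V = (\<Sum>u\<in>V. (Q s v u - 1 / card V) * Q t u w)"
      by (simp add: left_diff_distrib sum_subtractf Q_add v w Q_sum_col
          flip: sum_distrib_left sum_divide_distrib)
    also have "\<bar>\<dots>\<bar> \<le> (\<Sum>u\<in>V. \<bar>(Q s v u - 1 / card V) * Q t u w\<bar>)"
      by (rule sum_abs)
    finally show ?thesis
      by (simp add: abs_mult Q_nonneg)
  qed
  then have "(\<Sum>w\<in>V. \<bar>Q (s + t) v w - 1 / card V\<bar>)
      \<le> (\<Sum>w\<in>V. \<Sum>u\<in>V. \<bar>Q s v u - 1 / card V\<bar> * Q t u w)"
    by (rule sum_mono)
  also have "\<dots> = (\<Sum>u\<in>V. \<bar>Q s v u - 1 / card V\<bar>)"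
    by (subst sum.swap) (simp add: Q_sum flip: sum_distrib_left)
  finally show ?thesis by (simp add: dev_def)
qed

text \<open>The deviations sum to 0 over \<open>V\<close>, so what is lacking on \<open>W\<close> is
  in excess on \<open>V - W\<close>, and each accounts for at most half of the l1 norm.\<close>

lemma deficit_le_dev:
  assumes v: "v \<in> V" and W: "W \<subseteq> V"
  shows "card W / card V - (\<Sum>w\<in>W. Q t v w) \<le> dev t v"
proof -
  define d where "d w = Q t v w - 1 / card V" for w
  have "sum d V = 0"
    using v card_V_pos by (simp add: d_def sum_subtractf Q_sum)
  moreover have "sum f V = sum f W + sum f (V - W)" for f :: "'a \<Rightarrow> real"
    using finite_V W by (metis add.commute sum.subset_diff)
  moreover have "\<bar>sum d W\<bar> \<le> (\<Sum>w\<in>W. \<bar>d w\<bar>)" "\<bar>sum d (V - W)\<bar> \<le> (\<Sum>w\<in>V - W. \<bar>d w\<bar>)"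
    by (rule sum_abs)+
  ultimately have "- sum d W \<le> (\<Sum>w\<in>V. \<bar>d w\<bar>) / 2"
    by (smt (verit) field_sum_of_halves)
  then show ?thesis
    by (simp add: dev_def d_def sum_subtractf)
qed

section \<open>Visits to the vertices that rarely reach \<open>S\<close>\<close>

definition poor :: "nat \<Rightarrow> 'a set \<Rightarrow> 'a set" where
  "poor t S = {v \<in> V. (\<Sum>u\<in>S. Q t v u) < card S / card V / 2}"

lemma poor_subset: "poor t S \<subseteq> V"
  by (auto simp: poor_def)

text \<open>Double counting of the mass sent from \<open>S\<close> to the poor set. Each vertex of
  \<open>S\<close> sends at least the density of the poor set minus \<open>\<delta>\<close>; by
  symmetry the total is also what the poor vertices send to \<open>S\<close>, which is at most half
  the density of \<open>S\<close> each.\<close>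

lemma card_poor_le:
  fixes \<delta> :: real
  assumes S: "S \<subseteq> V" "S \<noteq> {}" and d: "\<And>v. v \<in> S \<Longrightarrow> dev t v \<le> \<delta>"
  shows "card (poor t S) \<le> 2 * \<delta> * card V"
proof -
  let ?W = "poor t S"
  have finS: "finite S" using S finite_V finite_subset by blast
  then have cS: "0 < card S" using S by (simp add: card_gt_0_iff)
  have "(\<Sum>v\<in>S. card ?W / card V - (\<Sum>w\<in>?W. Q t v w)) \<le> (\<Sum>v\<in>S. \<delta>)"
    using d deficit_le_dev[OF _ poor_subset] S by (intro sum_mono) (meson order.trans subsetD)
  then have "card S * (card ?W / card V) - (\<Sum>v\<in>S. \<Sum>w\<in>?W. Q t v w) \<le> card S * \<delta>"
    by (simp add: sum_subtractf)
  moreover have "(\<Sum>v\<in>S. \<Sum>w\<in>?W. Q t v w) = (\<Sum>w\<in>?W. \<Sum>v\<in>S. Q t w v)"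
    using S poor_subset by (subst sum.swap) (intro sum.cong refl Q_sym, auto)
  moreover have "(\<Sum>w\<in>?W. \<Sum>v\<in>S. Q t w v) \<le> (\<Sum>w\<in>?W. card S / card V / 2)"
    by (intro sum_mono) (simp add: poor_def)
  ultimately have "card S * (card ?W / card V) \<le> card S * (2 * \<delta>)"
    by (simp add: field_simps)
  then have "card ?W / card V \<le> 2 * \<delta>"
    using cS by (subst (asm) mult_le_cancel_left_pos) simp_all
  then show ?thesis
    using card_V_pos by (simp add: field_simps)
qed

text \<open>The expected number of visits to the poor set at times
  \<open>0, t, ..., (k - 1) * t\<close>, start included, computed by conditioning on the first round
  of \<open>t\<close> steps.\<close>

primrec poor_visits :: "nat \<Rightarrow> 'a set \<Rightarrow> nat \<Rightarrow> 'a \<Rightarrow> real" where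
  "poor_visits t S 0 v = 0"
| "poor_visits t S (Suc k) v = indicator (poor t S) v + (\<Sum>u\<in>V. Q t v u * poor_visits t S k u)"

lemma poor_visits_nonneg: "0 \<le> poor_visits t S k v"
  by (induction k arbitrary: v) (auto intro!: add_nonneg_nonneg sum_nonneg simp: Q_nonneg)

text \<open>Column sums 1: summed over all starting vertices, every round contributes the same
  amount.\<close>

lemma sum_poor_visits: "(\<Sum>v\<in>V. poor_visits t S k v) = k * card (poor t S)"
proof (induction k)
  case (Suc k)
  have "(\<Sum>v\<in>V. \<Sum>u\<in>V. Q t v u * poor_visits t S k u) = (\<Sum>u\<in>V. poor_visits t S k u)"
    by (subst sum.swap) (simp add: Q_sum_col flip: sum_distrib_right)
  moreover have "(\<Sum>v\<in>V. indicator (poor t S) v) = real (card (poor t S))"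
    using finite_V poor_subset[of t S] by (simp add: indicator_def sum.If_cases Int_absorb1)
  ultimately show ?case
    using Suc by (simp add: sum.distrib algebra_simps)
qed simp

text \<open>Induction on the number of rounds. At a poor start the indicator alone covers the
  trivial bound 1; at any other start one conditions on whether the first round ends in
  \<open>S\<close>.\<close>

lemma dev_multiple_le:
  fixes \<delta> \<epsilon> :: real
  assumes S: "S \<subseteq> V" and \<delta>: "0 \<le> \<delta>" and d: "\<And>v. v \<in> S \<Longrightarrow> dev t v \<le> \<delta>"
    and \<epsilon>: "0 \<le> \<epsilon>" "\<epsilon> \<le> 1" "\<epsilon> * card V \<le> card S"
    and v: "v \<in> V"
  shows "dev ((k + 1) * t) v \<le> \<delta> + (1 - \<epsilon> / 2) ^ k + poor_visits t S k v"
  using v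
proof (induction k arbitrary: v)
  case 0
  then show ?case using dev_le_1[of v t] \<delta> by simp
next
  case (Suc k)
  let ?c = "1 - \<epsilon> / 2" and ?g = "poor_visits t S k" and ?p = "\<Sum>u\<in>S. Q t v u"
  have c: "0 \<le> ?c" using \<epsilon> by simp
  show ?case
  proof (cases "v \<in> poor t S")
    case True
    have "0 \<le> (\<Sum>u\<in>V. Q t v u * ?g u)"
      by (intro sum_nonneg mult_nonneg_nonneg Q_nonneg poor_visits_nonneg)
    moreover have "0 \<le> ?c ^ Suc k" using c by simp
    ultimately show ?thesis
      using dev_le_1[OF Suc.prems, of "(Suc k + 1) * t"] True \<delta> by simp
  next
    case False
    have "card S / card V / 2 \<le> ?p"
      using False Suc.prems by (simp add: poor_def)
    moreover have "\<epsilon> \<le> card S / card V"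
      using \<epsilon> card_V_pos by (simp add: field_simps)
    ultimately have p: "\<epsilon> / 2 \<le> ?p"
      by (meson divide_right_mono order.trans zero_le_numeral)
    have split: "sum f V = sum f S + sum f (V - S)" for f :: "'a \<Rightarrow> real"
      using finite_V S by (metis add.commute sum.subset_diff)
    \<comment> \<open>A vertex of \<open>S\<close> is mixed after one round, and further rounds
      preserve this.\<close>
    have S_dev: "dev ((k + 1) * t) u \<le> \<delta>" if "u \<in> S" for u
      using dev_add_le[of u t "k * t"] d[OF that] S that by fastforce
    have "dev ((Suc k + 1) * t) v \<le> (\<Sum>u\<in>V. Q t v u * dev ((k + 1) * t) u)"
      using dev_add_le_average[OF Suc.prems, of t "(k + 1) * t"] by simp
    \<comment> \<open>In \<open>S\<close> the bound \<open>\<delta>\<close> suffices, so the power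
      from the induction hypothesis is charged only outside \<open>S\<close>, an event of
      probability at most \<open>?c\<close>.\<close>
    also have "\<dots> \<le> (\<Sum>u\<in>V. Q t v u * (\<delta> + indicator (V - S) u * ?c ^ k + ?g u))"
    proof (intro sum_mono mult_left_mono Q_nonneg)
      fix u assume "u \<in> V"
      then show "dev ((k + 1) * t) u \<le> \<delta> + indicator (V - S) u * ?c ^ k + ?g u"
        using Suc.IH[of u] S_dev[of u] poor_visits_nonneg[of t S k u] by (cases "u \<in> S") auto
    qed
    also have "\<dots> = \<delta> + ?c ^ k * (\<Sum>u\<in>V. Q t v u * indicator (V - S) u) + (\<Sum>u\<in>V. Q t v u * ?g u)"
    proof -
      have "(\<Sum>u\<in>V. \<delta> * Q t v u) = \<delta>"
        using Suc.prems by (simp add: Q_sum flip: sum_distrib_left)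
      then show ?thesis
        by (simp add: distrib_left sum.distrib mult_ac sum_distrib_left)
    qed
    also have "(\<Sum>u\<in>V. Q t v u * indicator (V - S) u) = 1 - ?p"
    proof -
      have "(\<Sum>u\<in>V. Q t v u * indicator (V - S) u) = (\<Sum>u\<in>V - S. Q t v u)"
        using split[of "\<lambda>u. Q t v u * indicator (V - S) u"] by simp
      then show ?thesis
        using split[of "Q t v"] Q_sum[OF Suc.prems, of t] by simp
    qed
    also have "?c ^ k * (1 - ?p) \<le> ?c ^ k * ?c"
      using p c by (intro mult_left_mono) auto
    finally show ?thesis
      using False by (simp add: mult_ac)
  qed
qed

text \<open>Markov's inequality: each counted vertex has \<open>poor_visits\<close> at least
  \<open>\<theta>\<close>, while the total over \<open>V\<close> is \<open>k\<close> times the size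
  of the poor set.\<close>

theorem card_dev_multiple_le:
  fixes \<delta> \<epsilon> \<theta> :: real
  assumes S: "S \<subseteq> V" "S \<noteq> {}" and \<delta>: "0 \<le> \<delta>" and d: "\<And>v. v \<in> S \<Longrightarrow> dev t v \<le> \<delta>"
    and \<epsilon>: "0 \<le> \<epsilon>" "\<epsilon> \<le> 1" "\<epsilon> * card V \<le> card S" and \<theta>: "0 < \<theta>"
  shows "card {v \<in> V. \<delta> + (1 - \<epsilon> / 2) ^ k + \<theta> < dev ((k + 1) * t) v}
    \<le> 2 * k * \<delta> / \<theta> * card V"
proof -
  let ?B = "{v \<in> V. \<delta> + (1 - \<epsilon> / 2) ^ k + \<theta> < dev ((k + 1) * t) v}"
  have "card ?B * \<theta> = (\<Sum>v\<in>?B. \<theta>)" by simp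
  also have "\<dots> \<le> (\<Sum>v\<in>?B. poor_visits t S k v)"
  proof (rule sum_mono)
    fix v assume "v \<in> ?B"
    then show "\<theta> \<le> poor_visits t S k v"
      using dev_multiple_le[OF S(1) \<delta> d \<epsilon>, of v k] by simp
  qed
  also have "\<dots> \<le> (\<Sum>v\<in>V. poor_visits t S k v)"
    using finite_V by (intro sum_mono2) (auto simp: poor_visits_nonneg)
  also have "\<dots> \<le> k * (2 * \<delta> * card V)"
    unfolding sum_poor_visits of_nat_mult using d
    by (intro mult_left_mono card_poor_le S) auto
  finally show ?thesis
    using \<theta> by (simp add: field_simps)
qed

end

section \<open>The random walk on a regular graph as such a semigroup\<close>

lemma walk_dist_add: "walk_dist G (s + t) v = bind_pmf (walk_dist G s v) (walk_dist G t)"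
  by (induction t) (simp_all add: bind_assoc_pmf bind_return_pmf')

lemma pmf_bind_sum:
  assumes "finite V" "set_pmf p \<subseteq> V"
  shows "pmf (bind_pmf p f) w = (\<Sum>u\<in>V. pmf p u * pmf (f u) w)"
  unfolding pmf_bind using assms by (subst integral_measure_pmf[of V]) auto

context
  fixes G :: "'a pair_pre_digraph" and D :: nat
  assumes reg: "regular_graph D G" and D: "D \<ge> 1"
begin

lemma finite_pverts: "finite (pverts G)"
proof -
  interpret pair_graph G using reg by (simp add: regular_graph_def)
  show ?thesis by (rule pair_finite_verts)
qed

lemma finite_neighbours: "finite (neighbours G v)"
  using finite_pverts by (simp add: neighbours_def)

lemma neighbours_nonempty: "v \<in> pverts G \<Longrightarrow> neighbours G v \<noteq> {}"
  using reg D by (auto simp: regular_graph_def)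

lemma neighbours_sym:
  "v \<in> pverts G \<Longrightarrow> w \<in> pverts G \<Longrightarrow> w \<in> neighbours G v \<longleftrightarrow> v \<in> neighbours G w"
proof -
  interpret pair_graph G using reg by (simp add: regular_graph_def)
  show "v \<in> pverts G \<Longrightarrow> w \<in> pverts G \<Longrightarrow> ?thesis"
    by (auto simp: neighbours_def intro: arcs_symmetric)
qed

text \<open>Regularity enters here: both ends of an edge have degree \<open>D\<close>, so it is
  crossed with probability \<open>1 / D\<close> in either direction.\<close>

lemma pmf_step_sym:
  assumes "v \<in> pverts G" "w \<in> pverts G"
  shows "pmf (pmf_of_set (neighbours G v)) w = pmf (pmf_of_set (neighbours G w)) v"
  using assms reg neighbours_sym[OF assms]
  by (simp add: pmf_of_set finite_neighbours neighbours_nonempty regular_graph_def indicator_def)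

lemma set_pmf_walk_dist: "v \<in> pverts G \<Longrightarrow> set_pmf (walk_dist G t v) \<subseteq> pverts G"
proof (induction t)
  case (Suc t)
  then show ?case
    using finite_neighbours neighbours_nonempty
    by (auto simp: set_pmf_of_set subset_iff) (auto simp: neighbours_def)
qed simp

lemma pmf_walk_dist_add:
  assumes "v \<in> pverts G"
  shows "pmf (walk_dist G (s + t) v) w
    = (\<Sum>u\<in>pverts G. pmf (walk_dist G s v) u * pmf (walk_dist G t u) w)"
  unfolding walk_dist_add using finite_pverts set_pmf_walk_dist[OF assms] by (rule pmf_bind_sum)

lemma pmf_walk_dist_sym:
  assumes "v \<in> pverts G" "w \<in> pverts G"
  shows "pmf (walk_dist G t v) w = pmf (walk_dist G t w) v"
  using assms
proof (induction t arbitrary: v w)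
  case 0
  then show ?case by (auto simp: indicator_def)
next
  case (Suc t)
  have one: "walk_dist G (Suc 0) u = pmf_of_set (neighbours G u)" for u
    by (simp add: bind_return_pmf)
  have "pmf (walk_dist G (t + Suc 0) v) w
      = (\<Sum>u\<in>pverts G. pmf (walk_dist G t v) u * pmf (walk_dist G (Suc 0) u) w)"
    by (rule pmf_walk_dist_add[OF Suc.prems(1)])
  \<comment> \<open>Path reversal: the last step of the walk from \<open>v\<close> becomes the first
    step of the walk from \<open>w\<close>.\<close>
  also have "\<dots> = (\<Sum>u\<in>pverts G. pmf (walk_dist G (Suc 0) w) u * pmf (walk_dist G t u) v)"
    unfolding one using Suc by (intro sum.cong) (simp_all add: pmf_step_sym mult.commute)
  also have "\<dots> = pmf (walk_dist G (Suc 0 + t) w) v"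
    by (rule pmf_walk_dist_add[OF Suc.prems(2), symmetric])
  finally show ?case by simp
qed

lemma walk_dist_semigroup:
  assumes "pverts G \<noteq> {}"
  shows "symmetric_markov_semigroup (pverts G) (\<lambda>t v. pmf (walk_dist G t v))"
  using assms finite_pverts set_pmf_walk_dist
  by unfold_locales (auto simp: sum_pmf_eq_1 pmf_walk_dist_add intro: pmf_walk_dist_sym)

lemma tv_dist_walk_dist:
  assumes v: "v \<in> pverts G"
  shows "tv_dist (pverts G) (walk_dist G t v) (pmf_of_set (pverts G))
    = symmetric_markov_semigroup.dev (pverts G) (\<lambda>t v. pmf (walk_dist G t v)) t v"
proof -
  have ne: "pverts G \<noteq> {}" using v by auto
  show ?thesis
    unfolding symmetric_markov_semigroup.dev_def[OF walk_dist_semigroup[OF ne]]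
    using finite_pverts ne set_pmf_walk_dist[OF v]
    by (subst tv_dist_half_sum) (auto simp: pmf_of_set)
qed

end

section \<open>Choice of the threshold and conclusion\<close>

lemma linear_le_powr:
  fixes C x p :: real
  assumes "0 < x" "x \<le> 1" "0 < C" "x \<le> 1 / C\<^sup>2" "p \<le> 1 / 2"
  shows "C * x \<le> x powr p"
proof -
  \<comment> \<open>With \<open>x\<close> split as \<open>sqrt x * sqrt x\<close>, one factor
    absorbs \<open>C\<close>; the other is at most \<open>x powr p\<close> because
    \<open>x \<le> 1\<close> and \<open>p \<le> 1 / 2\<close>.\<close>
  have "sqrt x \<le> 1 / C"
    using assms by (intro real_le_lsqrt) (auto simp: power_divide)
  then have "C * sqrt x \<le> 1" using assms by (simp add: field_simps)
  then have "C * sqrt x * sqrt x \<le> 1 * sqrt x"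
    using assms by (intro mult_right_mono) auto
  then have "C * x \<le> x powr (1 / 2)"
    using assms by (simp add: powr_half_sqrt mult.assoc)
  also have "\<dots> \<le> x powr p"
    using assms by (intro powr_mono') auto
  finally show ?thesis .
qed

theorem theorem1p7:
  fixes \<epsilon> :: real and M :: nat
  assumes "0 < \<epsilon>" and "\<epsilon> < 1 / 4" and "M \<ge> 1"
  shows "\<exists>\<delta>\<^sub>0 > 0. \<forall>\<delta>::real. 0 < \<delta> \<and> \<delta> < \<delta>\<^sub>0 \<longrightarrow>
    (\<forall>(\<tau>::nat) (n::nat) (D::nat) (\<Gamma> :: nat pair_pre_digraph).
      \<tau> \<ge> 1 \<and> n \<ge> 1 \<and> D \<ge> 1 \<and> pverts \<Gamma> = {1..n} \<and> regular_graph D \<Gamma> \<and>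
      real (card {v \<in> {1..n}. tv_dist {1..n} (walk_dist \<Gamma> \<tau> v) (pmf_of_set {1..n}) < \<delta>})
        \<ge> \<epsilon> * real n \<longrightarrow>
      real (card {v \<in> {1..n}.
          tv_dist {1..n} (walk_dist \<Gamma> ((M + 1) * \<tau>) v) (pmf_of_set {1..n})
            < 2 * exp (- \<epsilon> * real M / 2) + 6 * \<delta>})
        \<ge> (1 - (\<delta> / \<epsilon>) powr (1 / 4 ^ M)) * real n)"
proof -
  \<comment> \<open>\<open>\<theta>\<close> serves twice, as bound for
    \<open>(1 - \<epsilon> / 2) ^ M\<close> and as Markov threshold, whence the factor 2 in the
    conclusion. \<open>C\<close> turns the Markov bound \<open>2 * M * \<delta> / \<theta>\<close>
    into \<open>C * (\<delta> / \<epsilon>)\<close>.\<close>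
  define \<theta> where "\<theta> = exp (- \<epsilon> * real M / 2)"
  define C where "C = 2 * real M * \<epsilon> / \<theta>"
  have \<theta>: "0 < \<theta>" by (simp add: \<theta>_def)
  have C: "0 < C" using assms \<theta> by (simp add: C_def)
  have "(1 - \<epsilon> / 2) ^ M \<le> exp (- \<epsilon> / 2) ^ M"
    using assms exp_ge_add_one_self[of "- \<epsilon> / 2"] by (intro power_mono) auto
  also have "\<dots> = \<theta>"
    by (simp add: \<theta>_def mult.commute flip: exp_of_nat_mult)
  finally have pow_le: "(1 - \<epsilon> / 2) ^ M \<le> \<theta>" .
  have "(4::real) ^ 1 \<le> 4 ^ M"
    using assms by (intro power_increasing) auto
  then have exponent: "1 / 4 ^ M \<le> (1 / 2 :: real)"
    by (simp add: field_simps)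
  show ?thesis
  \<comment> \<open>The witness says that \<open>x = \<delta> / \<epsilon>\<close> is below both 1
    and \<open>1 / C\<^sup>2\<close>, as \<open>linear_le_powr\<close> demands.\<close>
  proof (intro exI[of _ "\<epsilon> * min 1 (1 / C\<^sup>2)"] conjI allI impI; (elim conjE)?)
    show "0 < \<epsilon> * min 1 (1 / C\<^sup>2)" using assms C by simp
  next
    fix \<delta> :: real and \<tau> n D :: nat and \<Gamma> :: "nat pair_pre_digraph"
    assume \<delta>: "0 < \<delta>" "\<delta> < \<epsilon> * min 1 (1 / C\<^sup>2)" and n: "1 \<le> n" and D: "1 \<le> D"
      and V: "pverts \<Gamma> = {1..n}" and reg: "regular_graph D \<Gamma>"
      and many: "\<epsilon> * real n
        \<le> card {v \<in> {1..n}. tv_dist {1..n} (walk_dist \<Gamma> \<tau> v) (pmf_of_set {1..n}) < \<delta>}"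
    interpret symmetric_markov_semigroup "{1..n}" "\<lambda>t v. pmf (walk_dist \<Gamma> t v)"
      using walk_dist_semigroup[OF reg D] n V by simp
    have tv: "tv_dist {1..n} (walk_dist \<Gamma> t v) (pmf_of_set {1..n}) = dev t v"
      if "v \<in> {1..n}" for t v
      using tv_dist_walk_dist[OF reg D] that V by simp
    define S where "S = {v \<in> {1..n}. dev \<tau> v < \<delta>}"
    define B where "B = {v \<in> {1..n}. \<delta> + (1 - \<epsilon> / 2) ^ M + \<theta> < dev ((M + 1) * \<tau>) v}"
    define T where "T = {v \<in> {1..n}. dev ((M + 1) * \<tau>) v < 2 * \<theta> + 6 * \<delta>}"
    have S: "\<epsilon> * real n \<le> card S"
      using many unfolding S_def by (simp only: tv cong: conj_cong)
    then have "0 < real (card S)"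
      using assms n by (smt (verit) mult_pos_pos of_nat_0_less_iff of_nat_1 of_nat_le_iff)
    then have "S \<noteq> {}" by auto
    then have "card B \<le> 2 * real M * \<delta> / \<theta> * card {1..n}"
      unfolding B_def
      using assms \<delta> \<theta> S by (intro card_dev_multiple_le[of S]) (auto simp: S_def)
    also have "\<dots> = C * (\<delta> / \<epsilon>) * n"
      using assms by (simp add: C_def)
    also have "\<dots> \<le> (\<delta> / \<epsilon>) powr (1 / 4 ^ M) * n"
    proof (intro mult_right_mono linear_le_powr exponent C)
      have "\<delta> / \<epsilon> < min 1 (1 / C\<^sup>2)"
        using \<delta>(2) assms(1) by (subst pos_divide_less_eq) (simp_all only: mult.commute)
      then show "\<delta> / \<epsilon> \<le> 1" "\<delta> / \<epsilon> \<le> 1 / C\<^sup>2" by auto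
    qed (use assms \<delta> in auto)
    finally have "card B \<le> (\<delta> / \<epsilon>) powr (1 / 4 ^ M) * n" .
    moreover have "n \<le> card B + card T"
    proof -
      \<comment> \<open>Outside \<open>B\<close> the distance is at most
        \<open>\<delta> + 2 * \<theta>\<close>, which is strictly below
        \<open>2 * \<theta> + 6 * \<delta>\<close> since \<open>\<delta>\<close> is
        positive.\<close>
      have "{1..n} \<subseteq> B \<union> T" using pow_le \<delta> by (auto simp: B_def T_def)
      then have "card {1..n} \<le> card (B \<union> T)"
        by (intro card_mono) (auto simp: B_def T_def)
      then show ?thesis using card_Un_le[of B T] by simp
    qed
    ultimately have "(1 - (\<delta> / \<epsilon>) powr (1 / 4 ^ M)) * n \<le> card T"
      by (simp add: algebra_simps)
    then show "(1 - (\<delta> / \<epsilon>) powr (1 / 4 ^ M)) * real n \<le> card {v \<in> {1..n}.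
          tv_dist {1..n} (walk_dist \<Gamma> ((M + 1) * \<tau>) v) (pmf_of_set {1..n})
            < 2 * exp (- \<epsilon> * real M / 2) + 6 * \<delta>}"
      unfolding T_def \<theta>_def by (simp only: tv cong: conj_cong)
  qed
qed

end
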